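(* Every doubly fractal sequence is a signature sequence: if $S$ is a doubly fractal sequence, then there exists a positive real number $\theta$ such that $S=S_\theta$.
   Context: All sequences are sequences $S=(s_1,s_2,\ldots)$ of positive integers. Suppose every positive integer occurs in $S$. The upper trimmed subsequence $\wedge_S$ is the sequence that remains after the first occurrence of every positive integer is removed from $S$. The lower trimmed subsequence $\vee_S$ is the sequence that remains after $1$ is subtracted from every term of $S$ and then all terms equal to $0$ are removed. $S$ is doubly fractal if $s_1=1$ and $\wedge_S=\vee_S=S$. For a positive real $\theta$, let $M_\theta$ be the multiset $\{i+j\theta : i,j\in\mathbb{N}\}$ ($\mathbb{N}$ the positive integers), arranged in nondecreasing order (repeated values, which occur exactly when $\theta$ is rational, listed with multiplicity) as $(t_h+a_h\theta)_{h\ge1}$ with $t_h,a_h\in\mathbb{N}$; the signature sequence of $\theta$ is $S_\theta=(t_1,t_2,t_3,\ldots)$. *)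

theory Defs
  imports Complex_Main "HOL-Library.Infinite_Set"
begin

text \<open>A sequence \<open>(s\<^sub>1, s\<^sub>2, \<dots>)\<close> of positive integers is a function \<open>s :: nat \<Rightarrow> nat\<close> with
  positive values and \<open>s n = s\<^bsub>n+1\<^esub>\<close>.\<close>

definition positive_seq :: "(nat \<Rightarrow> nat) \<Rightarrow> bool" where
  "positive_seq s \<longleftrightarrow> (\<forall>n. 0 < s n)"

text \<open>The sequence of the terms of \<open>s\<close> at the positions in \<open>I\<close>, in order. It is meaningful
  only for infinite \<open>I\<close>.\<close>

definition restrict_seq :: "(nat \<Rightarrow> nat) \<Rightarrow> nat set \<Rightarrow> nat \<Rightarrow> nat" where
  "restrict_seq s I = (\<lambda>n. s (enumerate I n))"

definition non_first_positions :: "(nat \<Rightarrow> nat) \<Rightarrow> nat set" where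
  "non_first_positions s = {n. \<exists>m<n. s m = s n}"

definition upper_trimmed :: "(nat \<Rightarrow> nat) \<Rightarrow> nat \<Rightarrow> nat" where
  "upper_trimmed s = restrict_seq s (non_first_positions s)"

definition lower_trimmed :: "(nat \<Rightarrow> nat) \<Rightarrow> nat \<Rightarrow> nat" where
  "lower_trimmed s = restrict_seq (\<lambda>n. s n - 1) {n. s n - 1 \<noteq> 0}"

text \<open>If only finitely many terms are left after upper trimming, the trimmed sequence is finite and
  hence different from \<open>s\<close>; the infinity condition excludes this case, in which
  \<^const>\<open>upper_trimmed\<close> has no meaning. For lower trimming infinitely many terms are
  always left, since every integer greater than 1 occurs.\<close>

definition doubly_fractal :: "(nat \<Rightarrow> nat) \<Rightarrow> bool" where
  "doubly_fractal s \<longleftrightarrow>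
     positive_seq s \<and> (\<forall>k>0. \<exists>n. s n = k) \<and> s 0 = 1 \<and>
     infinite (non_first_positions s) \<and> upper_trimmed s = s \<and> lower_trimmed s = s"

text \<open>The multiset of all \<open>i + j\<theta>\<close> with \<open>i, j \<ge> 1\<close> is listed with multiplicity by letting
  \<open>(t h, a h)\<close> run through every pair \<open>(i, j)\<close> exactly once. For rational \<open>\<theta>\<close> equal values may be
  listed in any order, so that this is a relation between \<open>\<theta>\<close> and \<open>t\<close>; fixing
  one order would be too restrictive: both \<open>1, 1, 2, 1, 2, 3, \<dots>\<close> and \<open>1, 2, 1, 3, 2, 1, \<dots>\<close> are doubly
  fractal, and both belong to \<open>\<theta> = 1\<close>.\<close>

definition signature_sequence_of :: "real \<Rightarrow> (nat \<Rightarrow> nat) \<Rightarrow> bool" where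
  "signature_sequence_of \<theta> t \<longleftrightarrow>
     (\<exists>a :: nat \<Rightarrow> nat. bij_betw (\<lambda>h. (t h, a h)) UNIV ({1..} \<times> {1..}) \<and>
        mono (\<lambda>h. real (t h) + real (a h) * \<theta>))"

end

theory Submission
  imports Defs
begin

text \<open>Number the occurrences of every value: position \<open>n\<close> carries the pair of \<open>s n\<close> and the rank of
  \<open>n\<close> among the occurrences of \<open>s n\<close>. If \<open>s\<close> is doubly fractal, this is a bijection between
  positions and pairs, and the order of the positions becomes a total order on pairs of positive
  integers: upper trimming says that it is invariant under increasing both ranks by one, lower
  trimming that it is invariant under increasing both values by one. A translation
  invariant order of type \<open>\<omega>\<close> is Archimedean, so, as in Hoelder's theorem, it is weakly compatible
  with a real weight \<open>i + j\<theta>\<close>, where \<open>\<theta>\<close> is a Dedekind cut.\<close>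

section \<open>Translation invariant orders on pairs and their real weights\<close>

locale translation_invariant_numbering =
  fixes P :: "nat \<Rightarrow> nat \<Rightarrow> nat" and right up :: "nat \<Rightarrow> nat"
  assumes P_Suc_left: "P (Suc i) j = right (P i j)"
    and P_Suc_right: "P i (Suc j) = up (P i j)"
    and strict_mono_right: "strict_mono right"
    and strict_mono_up: "strict_mono up"
    and right_greater: "n < right n"
    and up_greater: "n < up n"
begin

text \<open>Translation by \<open>(k, l)\<close> applies \<open>right\<close> k times and
  \<open>up\<close> l times, and both maps preserve and reflect the order.\<close>

lemma translate: "P (k + i) (l + j) < P (k + i') (l + j') \<longleftrightarrow> P i j < P i' j'"
proof (induction k)
  case 0
  show ?case
    by (induction l) (simp_all add: P_Suc_right strict_mono_less[OF strict_mono_up])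
qed (simp add: P_Suc_left strict_mono_less[OF strict_mono_right])

lemma strict_mono_left_argument: "strict_mono (\<lambda>i. P i j)"
  by (simp add: strict_mono_Suc_iff P_Suc_left right_greater)

lemma strict_mono_right_argument: "strict_mono (P i)"
  by (simp add: strict_mono_Suc_iff P_Suc_right up_greater)

lemma P_mono: "i \<le> i' \<Longrightarrow> j \<le> j' \<Longrightarrow> P i j \<le> P i' j'"
  using strict_mono_less_eq[OF strict_mono_left_argument]
    strict_mono_less_eq[OF strict_mono_right_argument] order_trans by metis

text \<open>One more copy of the comparison is added in two translated steps, through the pair
  \<open>(p, Suc n * q)\<close>. The factor is a successor because strictness fails for the multiple
  0.\<close>

lemma less_multiple_left:
  assumes "P p 0 < P 0 q"
  shows "P (Suc n * p) 0 < P 0 (Suc n * q)"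
proof (induction n)
  case (Suc n)
  have "P (p + Suc n * p) (0 + 0) < P (p + 0) (0 + Suc n * q)"
    using Suc by (simp only: translate)
  moreover have "P (0 + p) (Suc n * q + 0) < P (0 + 0) (Suc n * q + q)"
    using assms by (simp only: translate)
  ultimately show ?case by (simp add: ac_simps)
qed (use assms in simp)

lemma less_multiple_right:
  assumes "P 0 q < P p 0"
  shows "P 0 (Suc n * q) < P (Suc n * p) 0"
proof (induction n)
  case (Suc n)
  have "P (0 + 0) (q + Suc n * q) < P (0 + Suc n * p) (q + 0)"
    using Suc by (simp only: translate)
  moreover have "P (Suc n * p + 0) (0 + q) < P (Suc n * p + p) (0 + 0)"
    using assms by (simp only: translate)
  ultimately show ?case by (simp add: ac_simps)
qed (use assms in simp)

text \<open>Scaling by \<open>q'\<close> and by \<open>q\<close> gives both comparisons the same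
  middle term \<open>P 0 (q * q')\<close>; chaining them leaves a comparison along one axis, where
  the order is the usual one.\<close>

lemma ratio_less:
  assumes "P p 0 < P 0 q" "P 0 q' < P p' 0" "0 < q" "0 < q'"
  shows "real p / real q < real p' / real q'"
proof -
  have "P (q' * p) 0 < P 0 (q' * q)" "P 0 (q * q') < P (q * p') 0"
    using less_multiple_left[OF assms(1), of "q' - 1"]
      less_multiple_right[OF assms(2), of "q - 1"] assms(3,4) by simp_all
  then have "P (q' * p) 0 < P (q * p') 0" by (simp add: mult.commute)
  then have "q' * p < q * p'" using strict_mono_less[OF strict_mono_left_argument] by blast
  then have "real q' * real p < real q * real p'" by (metis of_nat_less_iff of_nat_mult)
  then show ?thesis using assms(3,4) by (simp add: divide_simps ac_simps)
qed

lemma ex_weight: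
  "\<exists>\<theta>::real. 0 < \<theta> \<and>
     (\<forall>i j i' j'. P i j < P i' j' \<longrightarrow> real i + real j * \<theta> \<le> real i' + real j' * \<theta>)"
proof -
  \<comment> \<open>A weight \<open>i + j * \<theta>\<close> compatible with
    \<open>P p 0 < P 0 q\<close> needs \<open>p / q \<le> \<theta>\<close>; these ratios form the
    lower part of the cut.\<close>
  define A where "A = {real p / real q | p q. 0 < q \<and> P p 0 < P 0 q}"
  define \<theta> where "\<theta> = Sup A"
  have upper: "x \<le> real p / real q" if "x \<in> A" "P 0 q < P p 0" "0 < q" for x p q
    using that ratio_less less_imp_le unfolding A_def by blast
  \<comment> \<open>Archimedean property: a strictly increasing sequence of naturals satisfies
    \<open>n \<le> P n 0\<close>, so enough steps to the right pass any position. This bounds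
    \<open>A\<close>.\<close>
  have "P 0 1 < P (Suc (P 0 1)) 0"
    using strict_mono_imp_increasing[OF strict_mono_left_argument] by (simp add: Suc_le_lessD)
  then have bdd: "bdd_above A"
    using upper by (meson bdd_aboveI zero_less_one)
  \<comment> \<open>The same argument upwards puts a positive ratio into \<open>A\<close>, so that
    \<open>A\<close> is nonempty and its supremum positive.\<close>
  define q0 where "q0 = Suc (P 1 0)"
  have "P 1 0 < P 0 q0"
    using strict_mono_imp_increasing[OF strict_mono_right_argument]
    unfolding q0_def by (simp add: Suc_le_lessD)
  then have mem: "1 / real q0 \<in> A"
    unfolding A_def q0_def by (force intro: exI[of _ "1::nat"])
  then have "1 / real q0 \<le> \<theta>"
    unfolding \<theta>_def using bdd by (rule cSup_upper)
  moreover have "0 < 1 / real q0" by (simp add: q0_def)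
  ultimately have pos: "0 < \<theta>" by linarith
  have "real i + real j * \<theta> \<le> real i' + real j' * \<theta>" if less: "P i j < P i' j'" for i j i' j'
  proof -
    \<comment> \<open>Componentwise comparable pairs are settled by monotonicity. Otherwise the
      common part is cancelled by translation, and the remaining comparison of the two axes places
      \<open>p / q\<close> above or below the cut.\<close>
    consider "i \<le> i'" "j \<le> j'" | "i' \<le> i" "j' \<le> j" | "i \<le> i'" "j' < j" | "i' \<le> i" "j < j'"
      by linarith
    then show ?thesis
    proof cases
      case 1
      then show ?thesis using pos by (intro add_mono mult_right_mono) auto
    next
      case 2
      then show ?thesis using P_mono less by (metis not_le)
    next
      case 3
      define p q where "p = i' - i" and "q = j - j'"
      have eqs: "i' = i + p" "j = j' + q" and "0 < q" using 3 by (auto simp: p_def q_def)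
      have "P (i + 0) (j' + q) < P (i + p) (j' + 0)" using less eqs by simp
      then have "P 0 q < P p 0" by (simp only: translate)
      then have "\<theta> \<le> real p / real q"
        unfolding \<theta>_def using mem upper \<open>0 < q\<close> by (intro cSup_least) auto
      then show ?thesis using \<open>0 < q\<close> by (simp add: eqs field_simps)
    next
      case 4
      define p q where "p = i - i'" and "q = j' - j"
      have eqs: "i = i' + p" "j' = j + q" and "0 < q" using 4 by (auto simp: p_def q_def)
      have "P (i' + p) (j + 0) < P (i' + 0) (j + q)" using less eqs by simp
      then have "P p 0 < P 0 q" by (simp only: translate)
      then have "real p / real q \<in> A" using \<open>0 < q\<close> unfolding A_def by blast
      then have "real p / real q \<le> \<theta>" unfolding \<theta>_def using bdd by (rule cSup_upper)
      then show ?thesis using \<open>0 < q\<close> by (simp add: eqs field_simps)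
    qed
  qed
  with pos show ?thesis by blast
qed

end

section \<open>Ranks of positions among equal values\<close>

definition occurrences :: "(nat \<Rightarrow> 'a) \<Rightarrow> nat \<Rightarrow> nat set" where
  "occurrences s n = {m. m \<le> n \<and> s m = s n}"

lemma finite_occurrences [simp]: "finite (occurrences s n)"
  by (simp add: occurrences_def)

lemma card_occurrences_pos: "0 < card (occurrences s n)"
  unfolding card_gt_0_iff by (auto simp: occurrences_def)

lemma card_occurrences_less:
  assumes "m < n" "s m = s n"
  shows "card (occurrences s m) < card (occurrences s n)"
proof (rule psubset_card_mono)
  have "n \<in> occurrences s n - occurrences s m" using assms by (auto simp: occurrences_def)
  moreover have "occurrences s m \<subseteq> occurrences s n" using assms by (auto simp: occurrences_def)
  ultimately show "occurrences s m \<subset> occurrences s n" by blast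
qed simp

lemma inj_value_rank: "inj (\<lambda>n. (s n, card (occurrences s n)))"
proof (rule injI)
  fix m n
  assume eq: "(s m, card (occurrences s m)) = (s n, card (occurrences s n))"
  show "m = n"
    using card_occurrences_less[of m n s] card_occurrences_less[of n m s] eq
    by (cases m n rule: linorder_cases) auto
qed

lemma card_occurrences_Least:
  fixes s :: "nat \<Rightarrow> 'a"
  assumes "s k = v"
  shows "card (occurrences s (LEAST m. s m = v)) = 1"
proof -
  have "occurrences s (LEAST m. s m = v) = {LEAST m. s m = v}"
    using LeastI[of "\<lambda>m. s m = v", OF assms] Least_le[of "\<lambda>m. s m = v"]
    unfolding occurrences_def by (auto intro: order_antisym)
  then show ?thesis by simp
qed

text \<open>\<open>enumerate I\<close> is increasing and onto \<open>I\<close>, so it matches the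
  occurrences counted on both sides. Only equality of values has to correspond, which leaves room
  for the shift of values in lower trimming.\<close>

lemma card_occurrences_enumerate:
  assumes "infinite I"
    and same: "\<And>m. s (enumerate I m) = s (enumerate I n) \<longleftrightarrow> t m = t n"
  shows "card (occurrences s (enumerate I n) \<inter> I) = card (occurrences t n)"
proof -
  have "occurrences s (enumerate I n) \<inter> I = enumerate I ` occurrences t n"
  proof (intro equalityI subsetI)
    fix x assume x: "x \<in> occurrences s (enumerate I n) \<inter> I"
    then obtain m where m: "x = enumerate I m" using enumerate_Ex[OF assms(1)] by (metis IntD2)
    with x assms show "x \<in> enumerate I ` occurrences t n"
      unfolding occurrences_def by (auto simp: strict_mono_less_eq[OF strict_mono_enumerate])
  next
    fix x assume "x \<in> enumerate I ` occurrences t n"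
    then show "x \<in> occurrences s (enumerate I n) \<inter> I"
      using assms unfolding occurrences_def
      by (auto simp: strict_mono_less_eq[OF strict_mono_enumerate] enumerate_in_set)
  qed
  moreover have "inj_on (enumerate I) (occurrences t n)"
    using strict_mono_enumerate[OF assms(1)] by (meson inj_on_subset strict_mono_imp_inj_on subset_UNIV)
  ultimately show ?thesis by (simp add: card_image)
qed

lemma enumerate_greater:
  fixes I :: "nat set"
  assumes "infinite I" "0 \<notin> I"
  shows "n < enumerate I n"
proof (induction n)
  case 0
  show ?case using enumerate_in_set[OF assms(1), of 0] assms(2) by (metis gr0I)
next
  case (Suc n)
  then show ?case using enumerate_step[OF assms(1), of n] by linarith
qed

section \<open>The numbering of pairs given by a doubly fractal sequence\<close>

context
  fixes s :: "nat \<Rightarrow> nat"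
  assumes fractal: "doubly_fractal s"
begin

text \<open>Both trimmings are read as maps sending \<open>n\<close> to the \<open>n\<close>-th
  surviving position. As enumerations they are increasing, which becomes translation
  invariance.\<close>

definition right :: "nat \<Rightarrow> nat" where "right = enumerate {n. s n - 1 \<noteq> 0}"
definition up :: "nat \<Rightarrow> nat" where "up = enumerate (non_first_positions s)"

abbreviation rank :: "nat \<Rightarrow> nat" where "rank n \<equiv> card (occurrences s n)"

lemma value_pos: "0 < s n"
  using fractal by (simp add: doubly_fractal_def positive_seq_def)

lemma ex_position: "0 < k \<Longrightarrow> \<exists>n. s n = k"
  using fractal by (simp add: doubly_fractal_def)

lemma infinite_non_first: "infinite (non_first_positions s)"
  using fractal by (simp add: doubly_fractal_def)

lemma infinite_greater_one: "infinite {n. s n - 1 \<noteq> 0}"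
proof
  assume "finite {n. s n - 1 \<noteq> 0}"
  then have "finite (s ` {n. s n - 1 \<noteq> 0})" by simp
  moreover have "{2..} \<subseteq> s ` {n. s n - 1 \<noteq> 0}"
  proof
    fix k :: nat assume "k \<in> {2..}"
    then show "k \<in> s ` {n. s n - 1 \<noteq> 0}" using ex_position[of k] by force
  qed
  ultimately show False using infinite_Ici finite_subset by blast
qed

lemma value_up: "s (up n) = s n"
  using fractal unfolding doubly_fractal_def upper_trimmed_def restrict_seq_def up_def by metis

lemma value_right: "s (right n) = Suc (s n)"
proof -
  have "s (right n) - 1 = s n"
    using fractal unfolding doubly_fractal_def lower_trimmed_def restrict_seq_def right_def by metis
  then show ?thesis using value_pos[of n] by linarith
qed

text \<open>Values above 1 lose no occurrence in lower trimming, so counting among the survivors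
  gives the full rank.\<close>

lemma rank_right: "rank (right n) = rank n"
proof -
  have "occurrences s (right n) \<subseteq> {n. s n - 1 \<noteq> 0}"
    using value_right[of n] value_pos[of n] by (auto simp: occurrences_def)
  then have "rank (right n) = card (occurrences s (right n) \<inter> {n. s n - 1 \<noteq> 0})"
    by (simp add: Int_absorb2)
  also have "\<dots> = rank n"
    unfolding right_def using infinite_greater_one
    by (rule card_occurrences_enumerate) (simp only: value_right[unfolded right_def] nat.inject)
  finally show ?thesis .
qed

text \<open>Upper trimming drops exactly one occurrence of the value, the first one
  \<open>f\<close>, and \<open>f\<close> precedes \<open>up n\<close>.\<close>

lemma rank_up: "rank (up n) = Suc (rank n)"
proof -
  define f where "f = (LEAST m. s m = s n)"
  have f: "s f = s n" and f_le: "f \<le> m" if "s m = s n" for m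
    unfolding f_def using that by (auto intro: LeastI Least_le)
  have "occurrences s (up n) = insert f (occurrences s (up n) \<inter> non_first_positions s)"
  proof (intro equalityI subsetI)
    fix m assume "m \<in> occurrences s (up n)"
    then have m: "m \<le> up n" "s m = s n" by (simp_all add: occurrences_def value_up)
    show "m \<in> insert f (occurrences s (up n) \<inter> non_first_positions s)"
    proof (cases "m = f")
      case False
      then have "f < m" using f_le[OF m(2)] by simp
      then show ?thesis
        using m f[OF m(2)] by (auto simp: occurrences_def non_first_positions_def value_up)
    qed simp
  next
    fix m assume "m \<in> insert f (occurrences s (up n) \<inter> non_first_positions s)"
    then show "m \<in> occurrences s (up n)"
      using f[of n] f_le[of "up n"] by (auto simp: occurrences_def value_up)
  qed
  moreover have "f \<notin> non_first_positions s"
    using f[of n] f_le by (force simp: non_first_positions_def)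
  ultimately have "rank (up n) = Suc (card (occurrences s (up n) \<inter> non_first_positions s))"
    by (metis card_insert_disjoint finite_Int finite_occurrences IntD2)
  also have "card (occurrences s (up n) \<inter> non_first_positions s) = rank n"
    unfolding up_def using infinite_non_first
    by (rule card_occurrences_enumerate) (simp only: value_up[unfolded up_def])
  finally show ?thesis .
qed

text \<open>The first occurrence has rank 1, and each application of \<open>up\<close> climbs one
  rank at the same value.\<close>

lemma ex_value_rank: "0 < i \<Longrightarrow> \<exists>n. s n = i \<and> rank n = Suc j"
proof (induction j)
  case 0
  then obtain k where "s k = i" using ex_position by blast
  then show ?case using card_occurrences_Least[of s k i] LeastI[of "\<lambda>m. s m = i"] by auto
next
  case (Suc j)
  then show ?case using value_up rank_up by metis
qed

lemma bij_value_rank: "bij_betw (\<lambda>n. (s n, rank n)) UNIV ({1..} \<times> {1..})"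
proof -
  have "(i, j) \<in> range (\<lambda>n. (s n, rank n))" if "1 \<le> i" "1 \<le> j" for i j
    using ex_value_rank[of i "j - 1"] that by force
  moreover have "1 \<le> s n" "1 \<le> rank n" for n
    using value_pos[of n] card_occurrences_pos[of s n] by (simp_all only: One_nat_def Suc_le_eq)
  ultimately show ?thesis
    unfolding bij_betw_def using inj_value_rank by fast
qed

text \<open>The inverse of the bijection between positions and pairs, with both indices shifted to
  start at 0 so that the axes pass through the origin.\<close>

definition position :: "nat \<Rightarrow> nat \<Rightarrow> nat" where
  "position i j = (THE n. s n = Suc i \<and> rank n = Suc j)"

lemma position_eqI: "s n = Suc i \<Longrightarrow> rank n = Suc j \<Longrightarrow> position i j = n"
  unfolding position_def by (rule the_equality) (auto intro: injD[OF inj_value_rank[of s]])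

lemma value_position: "s (position i j) = Suc i"
  and rank_position: "rank (position i j) = Suc j"
  using ex_value_rank[of "Suc i" j] position_eqI by auto

text \<open>Position 0 holds the first 1, so both trimmings remove it; hence \<open>right\<close>
  and \<open>up\<close> move every position strictly forward.\<close>

lemma zero_not_trimmed: "0 \<notin> {n. s n - 1 \<noteq> 0}" "0 \<notin> non_first_positions s"
  using fractal by (auto simp: doubly_fractal_def non_first_positions_def)

interpretation translation_invariant_numbering position right up
proof
  show "position (Suc i) j = right (position i j)" for i j
    by (rule position_eqI) (simp_all add: value_right rank_right value_position rank_position)
  show "position i (Suc j) = up (position i j)" for i j
    by (rule position_eqI) (simp_all add: value_up rank_up value_position rank_position)
  show "strict_mono right" "strict_mono up"
    unfolding right_def up_def
    by (intro strict_mono_enumerate infinite_greater_one infinite_non_first)+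
  show "n < right n" "n < up n" for n
    unfolding right_def up_def
    by (intro enumerate_greater infinite_greater_one infinite_non_first zero_not_trimmed)+
qed

lemma doubly_fractal_ex_weight: "\<exists>\<theta>::real. 0 < \<theta> \<and> signature_sequence_of \<theta> s"
proof -
  obtain \<theta> :: real where pos: "0 < \<theta>"
    and weight: "\<And>i j i' j'. position i j < position i' j' \<Longrightarrow>
      real i + real j * \<theta> \<le> real i' + real j' * \<theta>"
    using ex_weight by blast
  have "mono (\<lambda>n. real (s n) + real (rank n) * \<theta>)"
  proof (rule monoI)
    fix m n :: nat assume "m \<le> n"
    have shift: "\<exists>i j. position i j = n \<and> s n = Suc i \<and> rank n = Suc j" for n
      using position_eqI[of n "s n - 1" "rank n - 1"] value_pos[of n] card_occurrences_pos[of s n]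
      by (metis Suc_diff_1)
    obtain i j where ij: "position i j = m" "s m = Suc i" "rank m = Suc j" using shift by blast
    obtain i' j' where ij': "position i' j' = n" "s n = Suc i'" "rank n = Suc j'"
      using shift by blast
    show "real (s m) + real (rank m) * \<theta> \<le> real (s n) + real (rank n) * \<theta>"
    proof (cases "m = n")
      case False
      \<comment> \<open>Returning to indices from 1 adds the same \<open>1 + \<theta>\<close> to
        both sides.\<close>
      with \<open>m \<le> n\<close> show ?thesis using weight[of i j i' j'] ij ij' by (simp add: algebra_simps)
    qed simp
  qed
  with pos bij_value_rank show ?thesis
    \<comment> \<open>The multiplier of \<open>\<theta>\<close> at each position is its
      rank.\<close>
    unfolding signature_sequence_of_def by (intro exI[of _ \<theta>] exI[of _ rank] conjI)
qed

end

theorem theorem12: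
  fixes S :: "nat \<Rightarrow> nat"
  assumes "doubly_fractal S"
  shows "\<exists>\<theta>::real. 0 < \<theta> \<and> signature_sequence_of \<theta> S"
  using assms by (rule doubly_fractal_ex_weight)

end
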